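(* Let $(\mathbf{x}_i,\hat y_i,y_i^* )$, $i=1,\dots,N$, be i.i.d. samples from a distribution $\mathcal{D}$ on $\mathcal{X}\times\mathcal{Y}\times\mathcal{Y}$, and let $(t_1,t_2)\in\mathbb{R}^2$ be fixed thresholds. Let $I_i\in\{0,1\}$ be the selection indicator and $W_i$ the failure indicator of instance $i$ under the two-mode routing policy with thresholds $(t_1,t_2)$, as defined in the context. Assume $\Pr(I=1)>0$ and put $R(t_1,t_2)=\mathbb{E}[W\mid I=1]$, where $(I,W)$ denotes the pair for a generic draw from $\mathcal{D}$. Then the failure indicators over the selected subset are i.i.d. $\mathrm{Bernoulli}(R(t_1,t_2))$. That is, for every $S\subseteq\{1,\dots,N\}$ such that the event $\{\,\{i: I_i=1\}=S\,\}$ has positive probability, conditionally on this event the random variables $(W_i)_{i\in S}$ are independent and each has the $\mathrm{Bernoulli}(R(t_1,t_2))$ distribution.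
   Context: $\mathcal{X}$ (questions) and $\mathcal{Y}$ (answers) are measurable spaces. A sample is a triple $(\mathbf{x},\hat y,y^* )$ consisting of a question, a candidate answer and a ground-truth answer. The ground-truth evaluation label $e^*\in\{0,1\}$ is a (measurable) function of $(\mathbf{x},\hat y,y^* )$. For each instance there are two evaluation modes. Mode $k\in\{1,2\}$ produces a verdict $v_k\in\{0,1\}$ and a real-valued uncertainty score $U_k$. Mode 1 uses $(\mathbf{x},\hat y)$ only; Mode 2 also uses retrieved evidence, which is itself determined by the input. Thus $v_1,U_1,v_2,U_2$ are all fixed (measurable, deterministic) functions of $(\mathbf{x},\hat y)$. The correctness indicator of mode $k$ is $c_k=\mathbf{1}[v_k=e^*]$. Routing policy with thresholds $(t_1,t_2)$: output $v_1$ if $U_1\le t_1$; output $v_2$ if $U_1>t_1$ and $U_2\le t_2$; otherwise abstain. The selection indicator is $I=\mathbf{1}\{U_1\le t_1\}+\mathbf{1}\{U_1>t_1 \text{ and } U_2\le t_2\}\in\{0,1\}$. The correctness of the output verdict is $c=\mathbf{1}\{U_1\le t_1\}\,c_1+\mathbf{1}\{U_1>t_1\text{ and }U_2\le t_2\}\,c_2$, and the failure indicator is $W=1-c$ (used only for selected instances, $I=1$). Quantities with subscript $i$ are these functions evaluated at the $i$-th sample. *)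

theory Defs
  imports "HOL-Probability.Probability"
begin

text \<open>
  A sample is a triple (question, candidate answer, ground-truth answer). Verdicts and evaluation
  labels in {0,1} are of type \<^typ>\<open>bool\<close>. The modes are indexed by 1 and 2, and the
  verdicts \<open>v k\<close> and uncertainty scores \<open>U k\<close> only see the question and the candidate answer.
\<close>

definition mode_correct ::
  "(nat \<Rightarrow> 'x \<times> 'y \<Rightarrow> bool) \<Rightarrow> ('x \<times> 'y \<times> 'y \<Rightarrow> bool) \<Rightarrow> nat \<Rightarrow> 'x \<times> 'y \<times> 'y \<Rightarrow> real" where
  "mode_correct v e k = (\<lambda>(x, y, y'). of_bool (v k (x, y) = e (x, y, y')))"

definition use_mode1 :: "(nat \<Rightarrow> 'x \<times> 'y \<Rightarrow> real) \<Rightarrow> real \<Rightarrow> 'x \<times> 'y \<times> 'y \<Rightarrow> real" where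
  "use_mode1 U t1 = (\<lambda>(x, y, y'). of_bool (U 1 (x, y) \<le> t1))"

definition use_mode2 :: "(nat \<Rightarrow> 'x \<times> 'y \<Rightarrow> real) \<Rightarrow> real \<Rightarrow> real \<Rightarrow> 'x \<times> 'y \<times> 'y \<Rightarrow> real" where
  "use_mode2 U t1 t2 = (\<lambda>(x, y, y'). of_bool (U 1 (x, y) > t1 \<and> U 2 (x, y) \<le> t2))"

definition selected :: "(nat \<Rightarrow> 'x \<times> 'y \<Rightarrow> real) \<Rightarrow> real \<Rightarrow> real \<Rightarrow> 'x \<times> 'y \<times> 'y \<Rightarrow> real" where
  "selected U t1 t2 z = use_mode1 U t1 z + use_mode2 U t1 t2 z"

definition output_correct ::
  "(nat \<Rightarrow> 'x \<times> 'y \<Rightarrow> bool) \<Rightarrow> (nat \<Rightarrow> 'x \<times> 'y \<Rightarrow> real) \<Rightarrow> ('x \<times> 'y \<times> 'y \<Rightarrow> bool) \<Rightarrow>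
    real \<Rightarrow> real \<Rightarrow> 'x \<times> 'y \<times> 'y \<Rightarrow> real" where
  "output_correct v U e t1 t2 z =
     use_mode1 U t1 z * mode_correct v e 1 z + use_mode2 U t1 t2 z * mode_correct v e 2 z"

definition failure ::
  "(nat \<Rightarrow> 'x \<times> 'y \<Rightarrow> bool) \<Rightarrow> (nat \<Rightarrow> 'x \<times> 'y \<Rightarrow> real) \<Rightarrow> ('x \<times> 'y \<times> 'y \<Rightarrow> bool) \<Rightarrow>
    real \<Rightarrow> real \<Rightarrow> 'x \<times> 'y \<times> 'y \<Rightarrow> real" where
  "failure v U e t1 t2 z = 1 - output_correct v U e t1 t2 z"

text \<open>
  Conditioning on an event \<open>A\<close> of positive probability is \<^term>\<open>uniform_measure M A\<close>, which maps
  \<open>B\<close> to the probability of the intersection of \<open>A\<close> and \<open>B\<close> divided by that of \<open>A\<close>.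
\<close>

definition failure_rate ::
  "('x \<times> 'y \<times> 'y) measure \<Rightarrow> (nat \<Rightarrow> 'x \<times> 'y \<Rightarrow> bool) \<Rightarrow> (nat \<Rightarrow> 'x \<times> 'y \<Rightarrow> real) \<Rightarrow>
    ('x \<times> 'y \<times> 'y \<Rightarrow> bool) \<Rightarrow> real \<Rightarrow> real \<Rightarrow> real" where
  "failure_rate D v U e t1 t2 =
     (LINT z | uniform_measure D {z \<in> space D. selected U t1 t2 z = 1}. failure v U e t1 t2 z)"

definition selection_event ::
  "'w measure \<Rightarrow> nat \<Rightarrow> (nat \<Rightarrow> 'w \<Rightarrow> 'x \<times> 'y \<times> 'y) \<Rightarrow> (nat \<Rightarrow> 'x \<times> 'y \<Rightarrow> real) \<Rightarrow>
    real \<Rightarrow> real \<Rightarrow> nat set \<Rightarrow> 'w set" where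
  "selection_event P N Z U t1 t2 S =
     {\<omega> \<in> space P. {i \<in> {1..N}. selected U t1 t2 (Z i \<omega>) = 1} = S}"

end

theory Submission imports Defs begin

text \<open>
  The event that \<open>S\<close> is the selected subset is an intersection of one constraint per sample. By
  independence, conditioning on such an intersection conditions every sample separately on its own
  constraint: the samples stay independent, and those in \<open>S\<close> acquire the conditional law of \<open>D\<close>
  given selection. Under that law the failure indicator takes only the values 0 and 1 and has
  mean \<open>R(t1, t2)\<close>.
\<close>

lemma sets_box:
  assumes "finite I" "\<And>i. i \<in> I \<Longrightarrow> Z i \<in> measurable M (N i)"
    and "\<And>i. i \<in> I \<Longrightarrow> B i \<in> sets (N i)"
  shows "{\<omega> \<in> space M. \<forall>i\<in>I. Z i \<omega> \<in> B i} \<in> sets M"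
proof (rule sets.sets_Collect_finite_All[OF _ assms(1)])
  fix i assume i: "i \<in> I"
  have "{\<omega> \<in> space M. Z i \<omega> \<in> B i} = Z i -` B i \<inter> space M"
    by auto
  then show "{\<omega> \<in> space M. Z i \<omega> \<in> B i} \<in> sets M"
    using measurable_sets[OF assms(2,3)[OF i]] by simp
qed

lemma (in prob_space) indep_vars_prob_box:
  assumes "indep_vars N Z I" "finite I" "\<And>i. i \<in> I \<Longrightarrow> B i \<in> sets (N i)"
  shows "prob {\<omega> \<in> space M. \<forall>i\<in>I. Z i \<omega> \<in> B i} = (\<Prod>i\<in>I. prob (Z i -` B i \<inter> space M))"
\<comment> \<open>An empty intersection would be \<open>UNIV\<close> instead of
  \<open>space M\<close>, so the empty index set is settled separately; there both sides are
  1.\<close>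
proof (cases "I = {}")
  case True
  then show ?thesis by (simp add: prob_space)
next
  case False
  have "{\<omega> \<in> space M. \<forall>i\<in>I. Z i \<omega> \<in> B i} = (\<Inter>i\<in>I. Z i -` B i \<inter> space M)"
    using False by auto
  then show ?thesis
    using indep_varsD_finite[OF assms(1) False assms(2,3)] by simp
qed

text \<open>The routing policy enters only through the choice of one constraint set
  \<open>E i\<close> per sample, so the conditioning is carried out for arbitrary
  constraints.\<close>

locale conditioned_indep_vars = prob_space M
  for M :: "'w measure" and N :: "'i \<Rightarrow> 'b measure" and Z :: "'i \<Rightarrow> 'w \<Rightarrow> 'b"
    and I :: "'i set" and E :: "'i \<Rightarrow> 'b set" +
  assumes indep: "indep_vars N Z I"
    and finite_I: "finite I"
    and E_sets: "\<And>i. i \<in> I \<Longrightarrow> E i \<in> sets (N i)"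
    and cond_event_pos: "prob {\<omega> \<in> space M. \<forall>i\<in>I. Z i \<omega> \<in> E i} > 0"
begin

definition "cond_event = {\<omega> \<in> space M. \<forall>i\<in>I. Z i \<omega> \<in> E i}"

abbreviation "Q \<equiv> uniform_measure M cond_event"

text \<open>Conditional probability under \<open>M\<close> given the constraint on
  \<open>Z i\<close> alone, whereas \<open>Q\<close> imposes all the constraints at once.\<close>

definition "cond_prob_at i B = prob (Z i -` (E i \<inter> B) \<inter> space M) / prob (Z i -` E i \<inter> space M)"

lemma Z_measurable [measurable]: "i \<in> I \<Longrightarrow> Z i \<in> measurable M (N i)"
  using indep unfolding indep_vars_def by auto

lemma emeasure_cond_event: "emeasure M cond_event \<noteq> 0"
  using cond_event_pos by (simp add: cond_event_def emeasure_eq_measure)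

lemma prob_cond_event: "prob cond_event = (\<Prod>i\<in>I. prob (Z i -` E i \<inter> space M))"
  unfolding cond_event_def by (rule indep_vars_prob_box[OF indep finite_I E_sets])

text \<open>A vanishing factor would make the product \<open>prob cond_event\<close> zero.\<close>

lemma component_pos: "i \<in> I \<Longrightarrow> prob (Z i -` E i \<inter> space M) > 0"
  using cond_event_pos prob_cond_event finite_I unfolding cond_event_def
  by (metis prod_zero_iff zero_less_measure_iff)

lemma Q_prob_space: "prob_space Q"
  by (rule prob_space_uniform_measure) (simp_all add: emeasure_cond_event)

text \<open>Intersecting the conditioning event with a box gives the box with sides
  \<open>E i \<inter> B i\<close>. Numerator and denominator of the conditional probability both
  factor by independence, hence so does the quotient.\<close>

lemma Q_box:
  assumes B: "\<And>i. i \<in> I \<Longrightarrow> B i \<in> sets (N i)"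
  shows "measure Q {\<omega> \<in> space M. \<forall>i\<in>I. Z i \<omega> \<in> B i} = (\<Prod>i\<in>I. cond_prob_at i (B i))"
proof -
  have "{\<omega> \<in> space M. \<forall>i\<in>I. Z i \<omega> \<in> B i} \<in> sets M"
    by (rule sets_box[OF finite_I Z_measurable B])
  then have "measure Q {\<omega> \<in> space M. \<forall>i\<in>I. Z i \<omega> \<in> B i}
      = prob (cond_event \<inter> {\<omega> \<in> space M. \<forall>i\<in>I. Z i \<omega> \<in> B i}) / prob cond_event"
    by (rule measure_uniform_measure[rotated 2]) (simp_all add: emeasure_cond_event)
  also have "cond_event \<inter> {\<omega> \<in> space M. \<forall>i\<in>I. Z i \<omega> \<in> B i} = {\<omega> \<in> space M. \<forall>i\<in>I. Z i \<omega> \<in> E i \<inter> B i}"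
    unfolding cond_event_def by auto
  also have "prob \<dots> = (\<Prod>i\<in>I. prob (Z i -` (E i \<inter> B i) \<inter> space M))"
    by (rule indep_vars_prob_box[OF indep finite_I]) (use B E_sets in auto)
  finally show ?thesis
    unfolding cond_prob_at_def prob_cond_event by (simp add: prod_dividef)
qed

text \<open>An event about one coordinate is a box whose other sides are whole spaces. Their factors
  are 1, so the constraints on the other samples have no effect on the law of
  \<open>Z i\<close>.\<close>

lemma Q_component:
  assumes i: "i \<in> I" and B: "B \<in> sets (N i)"
  shows "measure Q (Z i -` B \<inter> space M) = cond_prob_at i B"
proof -
  define B' where "B' = (\<lambda>j. if j = i then B else space (N j))"
  have "Z i -` B \<inter> space M = {\<omega> \<in> space M. \<forall>j\<in>I. Z j \<omega> \<in> B' j}"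
    using i measurable_space[OF Z_measurable] by (auto simp: B'_def)
  then have "measure Q (Z i -` B \<inter> space M) = (\<Prod>j\<in>I. cond_prob_at j (B' j))"
    using Q_box[of B'] B by (simp add: B'_def)
  also have "\<dots> = (\<Prod>j\<in>I. if j = i then cond_prob_at i B else 1)"
  proof (rule prod.cong)
    fix j assume j: "j \<in> I"
    then have "E j \<inter> space (N j) = E j"
      using sets.sets_into_space[OF E_sets] by auto
    then show "cond_prob_at j (B' j) = (if j = i then cond_prob_at i B else 1)"
      \<comment> \<open>For \<open>j \<noteq> i\<close> numerator and denominator agree; positivity
        makes the quotient 1.\<close>
      using component_pos[OF j] by (simp add: B'_def cond_prob_at_def del: vimage_Int)
  qed simp
  also have "\<dots> = cond_prob_at i B"
    using finite_I i by simp
  finally show ?thesis .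
qed

lemma indep_vars_Q: "prob_space.indep_vars Q N Z I"
proof (cases "I = {}")
  case True
  then show ?thesis
    unfolding prob_space.indep_vars_def[OF Q_prob_space] prob_space.indep_sets_def[OF Q_prob_space]
    by simp
next
  case False
  have "(\<Inter>j\<in>I. Z j -` B j \<inter> space M) = {\<omega> \<in> space M. \<forall>i\<in>I. Z i \<omega> \<in> B i}" for B
    using False by auto
  then have "measure Q (\<Inter>j\<in>I. Z j -` B j \<inter> space M) = (\<Prod>j\<in>I. measure Q (Z j -` B j \<inter> space M))"
    if "B \<in> (\<Pi> i\<in>I. sets (N i))" for B
    using that by (simp add: Q_box Q_component Pi_iff)
  \<comment> \<open>All of \<open>sets (N i)\<close> serves as the intersection-stable generator. It
    contains the whole space, so the product formula over the full index set also covers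
    subfamilies.\<close>
  then show ?thesis
    by (subst prob_space.indep_vars_finite[OF Q_prob_space, where E = "\<lambda>i. sets (N i)"])
      (auto simp: False finite_I sets.sigma_sets_eq sets.space_closed sets.Int_stable)
qed

text \<open>Both sides are probability measures, so it suffices to compare real values, and there
  both reduce to \<open>cond_prob_at i B\<close>.\<close>

lemma distr_Q:
  assumes i: "i \<in> I"
  shows "distr Q (N i) (Z i) = uniform_measure (distr M (N i) (Z i)) (E i)"
proof (rule measure_eqI)
  fix B assume "B \<in> sets (distr Q (N i) (Z i))"
  then have B: "B \<in> sets (N i)" by simp
  interpret Q: prob_space Q by (rule Q_prob_space)
  interpret D: prob_space "distr M (N i) (Z i)"
    by (rule prob_space_distr) (use i in measurable)
  have E: "emeasure (distr M (N i) (Z i)) (E i) \<noteq> 0"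
    using component_pos[OF i] i E_sets by (auto simp: emeasure_distr emeasure_eq_measure)
  interpret D': prob_space "uniform_measure (distr M (N i) (Z i)) (E i)"
    by (rule prob_space_uniform_measure) (use E in simp_all)
  have "emeasure (distr Q (N i) (Z i)) B = measure Q (Z i -` B \<inter> space M)"
    using B i by (subst emeasure_distr) (auto simp: Q.emeasure_eq_measure)
  also have "measure Q (Z i -` B \<inter> space M)
      = measure (uniform_measure (distr M (N i) (Z i)) (E i)) B"
    using B i E_sets
    by (simp add: Q_component measure_uniform_measure[OF E] measure_distr cond_prob_at_def)
  finally show "emeasure (distr Q (N i) (Z i)) B
      = emeasure (uniform_measure (distr M (N i) (Z i)) (E i)) B"
    by (simp add: D'.emeasure_eq_measure)
qed simp

end

text \<open>The mean of a variable with values 0 and 1 is the probability of the value 1, which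
  determines its law.\<close>

lemma (in prob_space) distr_zero_one_eq_bernoulli:
  fixes X :: "'a \<Rightarrow> real"
  assumes [measurable]: "X \<in> borel_measurable M" and X01: "\<And>\<omega>. \<omega> \<in> space M \<Longrightarrow> X \<omega> \<in> {0, 1}"
  shows "distr M borel X = distr (measure_pmf (bernoulli_pmf (expectation X))) borel of_bool"
proof -
  define A where "A = {\<omega> \<in> space M. X \<omega> = 1}"
  have A [measurable]: "A \<in> sets M" unfolding A_def by measurable
  have "expectation X = expectation (indicator A)"
    using X01 by (intro Bochner_Integration.integral_cong) (auto simp: A_def indicator_def)
  then have p: "expectation X = prob A" by simp
  \<comment> \<open>The laws are compared on the two-point space \<open>bool\<close>, where
    singletons suffice, and then pushed forward to the reals by \<open>of_bool\<close>.\<close>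
  have "distr M (count_space UNIV) (\<lambda>\<omega>. X \<omega> = 1) = measure_pmf (bernoulli_pmf (expectation X))"
    (is "?L = ?R")
  proof (rule measure_eqI_countable[where A = UNIV])
    fix b :: bool
    have "(\<lambda>\<omega>. X \<omega> = 1) -` {b} \<inter> space M = (if b then A else space M - A)"
      by (auto simp: A_def)
    then have "emeasure ?L {b} = prob (if b then A else space M - A)"
      by (subst emeasure_distr) (auto simp: emeasure_eq_measure)
    also have "\<dots> = emeasure ?R {b}"
      by (cases b) (simp_all add: p emeasure_pmf_single prob_compl[OF A])
    finally show "emeasure ?L {b} = emeasure ?R {b}" .
  qed auto
  moreover have "X \<omega> = of_bool (X \<omega> = 1)" if "\<omega> \<in> space M" for \<omega>
    using X01[OF that] by auto
  then have "distr M borel X = distr ?L borel of_bool"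
    by (subst distr_distr) (auto simp: comp_def intro!: distr_cong)
  ultimately show ?thesis by simp
qed

text \<open>The two mode indicators are never both 1, so at most one correctness term survives. An
  unselected sample gets the value 1.\<close>

lemma failure_zero_one: "failure v U e t1 t2 z \<in> {0, 1}"
  by (cases z) (auto simp: failure_def output_correct_def use_mode1_def use_mode2_def mode_correct_def)

lemma selected_measurable:
  assumes [measurable]: "U 1 \<in> borel_measurable (MX \<Otimes>\<^sub>M MY)" "U 2 \<in> borel_measurable (MX \<Otimes>\<^sub>M MY)"
  shows "selected U t1 t2 \<in> borel_measurable (MX \<Otimes>\<^sub>M MY \<Otimes>\<^sub>M MY)"
  unfolding selected_def[abs_def] use_mode1_def use_mode2_def by measurable

lemma failure_measurable:
  assumes [measurable]: "v 1 \<in> measurable (MX \<Otimes>\<^sub>M MY) (count_space UNIV)"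
      "v 2 \<in> measurable (MX \<Otimes>\<^sub>M MY) (count_space UNIV)"
      "U 1 \<in> borel_measurable (MX \<Otimes>\<^sub>M MY)" "U 2 \<in> borel_measurable (MX \<Otimes>\<^sub>M MY)"
      "e \<in> measurable (MX \<Otimes>\<^sub>M MY \<Otimes>\<^sub>M MY) (count_space UNIV)"
  shows "failure v U e t1 t2 \<in> borel_measurable (MX \<Otimes>\<^sub>M MY \<Otimes>\<^sub>M MY)"
  unfolding failure_def[abs_def] output_correct_def use_mode1_def use_mode2_def mode_correct_def
  by measurable

theorem lemma1:
  fixes MX :: "'x measure" and MY :: "'y measure"
    and D :: "('x \<times> 'y \<times> 'y) measure"
    and P :: "'w measure"
    and N :: nat
    and Z :: "nat \<Rightarrow> 'w \<Rightarrow> 'x \<times> 'y \<times> 'y"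
    and v :: "nat \<Rightarrow> 'x \<times> 'y \<Rightarrow> bool"
    and U :: "nat \<Rightarrow> 'x \<times> 'y \<Rightarrow> real"
    and e :: "'x \<times> 'y \<times> 'y \<Rightarrow> bool"
    and t1 t2 :: real
  assumes "prob_space D"
    and "sets D = sets (MX \<Otimes>\<^sub>M MY \<Otimes>\<^sub>M MY)"
    and "\<And>k. k \<in> {1, 2} \<Longrightarrow> v k \<in> measurable (MX \<Otimes>\<^sub>M MY) (count_space UNIV)"
    and "\<And>k. k \<in> {1, 2} \<Longrightarrow> U k \<in> borel_measurable (MX \<Otimes>\<^sub>M MY)"
    and "e \<in> measurable (MX \<Otimes>\<^sub>M MY \<Otimes>\<^sub>M MY) (count_space UNIV)"
    and "prob_space P"
    and "prob_space.indep_vars P (\<lambda>_. MX \<Otimes>\<^sub>M MY \<Otimes>\<^sub>M MY) Z {1..N}"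
    and "\<And>i. i \<in> {1..N} \<Longrightarrow> distr P (MX \<Otimes>\<^sub>M MY \<Otimes>\<^sub>M MY) (Z i) = D"
    and "measure D {z \<in> space D. selected U t1 t2 z = 1} > 0"
  shows "\<forall>S \<subseteq> {1..N}. measure P (selection_event P N Z U t1 t2 S) > 0 \<longrightarrow>
    prob_space.indep_vars (uniform_measure P (selection_event P N Z U t1 t2 S))
      (\<lambda>_. borel) (\<lambda>i \<omega>. failure v U e t1 t2 (Z i \<omega>)) S \<and>
    (\<forall>i \<in> S. distr (uniform_measure P (selection_event P N Z U t1 t2 S)) borel
                (\<lambda>\<omega>. failure v U e t1 t2 (Z i \<omega>)) =
              distr (measure_pmf (bernoulli_pmf (failure_rate D v U e t1 t2))) borel of_bool)"
proof (intro allI impI)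
  fix S assume S: "S \<subseteq> {1..N}" and pos: "measure P (selection_event P N Z U t1 t2 S) > 0"
  let ?M = "MX \<Otimes>\<^sub>M MY \<Otimes>\<^sub>M MY"
  let ?f = "failure v U e t1 t2"
  let ?C = "uniform_measure P (selection_event P N Z U t1 t2 S)"
  have f [measurable]: "?f \<in> borel_measurable ?M"
    by (rule failure_measurable) (use assms(3-5) in auto)
  have [measurable]: "selected U t1 t2 \<in> borel_measurable ?M"
    by (rule selected_measurable) (use assms(3-5) in auto)
  interpret P: prob_space P by fact
  \<comment> \<open>The event prescribes the selected set exactly, so samples outside
    \<open>S\<close> are constrained too: they must not be selected.\<close>
  define E where "E = (\<lambda>i. {z \<in> space ?M. (selected U t1 t2 z = 1) = (i \<in> S)})"
  have Z: "Z i \<in> measurable P ?M" if "i \<in> {1..N}" for i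
    using assms(7) that unfolding P.indep_vars_def by auto
  have event: "selection_event P N Z U t1 t2 S = {\<omega> \<in> space P. \<forall>i\<in>{1..N}. Z i \<omega> \<in> E i}"
    using S measurable_space[OF Z] unfolding selection_event_def E_def by blast
  interpret C: conditioned_indep_vars P "\<lambda>_. ?M" Z "{1..N}" E
  proof
    show "E i \<in> sets ?M" for i unfolding E_def by measurable
    show "measure P {\<omega> \<in> space P. \<forall>i\<in>{1..N}. Z i \<omega> \<in> E i} > 0"
      using pos unfolding event .
  qed (use assms(7) in simp_all)
  have C: "C.Q = ?C" unfolding C.cond_event_def event ..
  interpret Q: prob_space ?C using C.Q_prob_space unfolding C .
  \<comment> \<open>Conditioning involves all \<open>N\<close> samples; only afterwards is the
    family restricted to \<open>S\<close> and composed with the failure indicator.\<close>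
  have "Q.indep_vars (\<lambda>_. ?M) Z S"
    using C.indep_vars_Q S unfolding C by (rule Q.indep_vars_subset)
  then have "Q.indep_vars (\<lambda>_. borel) (\<lambda>i \<omega>. ?f (Z i \<omega>)) S"
    by (rule Q.indep_vars_compose2) (rule f)
  moreover have "distr ?C borel (\<lambda>\<omega>. ?f (Z i \<omega>))
      = distr (measure_pmf (bernoulli_pmf (failure_rate D v U e t1 t2))) borel of_bool"
    if i: "i \<in> S" for i
  proof -
    from i S have iN: "i \<in> {1..N}" by auto
    let ?D = "uniform_measure D {z \<in> space D. selected U t1 t2 z = 1}"
    \<comment> \<open>For \<open>i \<in> S\<close> the constraint is selection itself, the same for
      every such \<open>i\<close>; this gives the common conditional law \<open>?D\<close>.\<close>
    have "E i = {z \<in> space D. selected U t1 t2 z = 1}"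
      using i sets_eq_imp_space_eq[OF assms(2)] by (simp add: E_def)
    then have law: "distr ?C ?M (Z i) = ?D"
      using C.distr_Q[OF iN] assms(8)[OF iN] unfolding C by simp
    have Zi: "Z i \<in> measurable ?C ?M" using Z[OF iN] by simp
    interpret D: prob_space ?D
      unfolding law[symmetric] by (rule Q.prob_space_distr[OF Zi])
    have "distr ?C borel (\<lambda>\<omega>. ?f (Z i \<omega>)) = distr ?D borel ?f"
      unfolding law[symmetric] distr_distr[OF f Zi] comp_def ..
    \<comment> \<open>The mean of \<open>?f\<close> under \<open>?D\<close> is the failure rate by
      definition.\<close>
    also have "\<dots> = distr (measure_pmf (bernoulli_pmf (D.expectation ?f))) borel of_bool"
    proof (rule D.distr_zero_one_eq_bernoulli)
      show "?f \<in> borel_measurable ?D"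
        unfolding law[symmetric] by simp
    qed (rule failure_zero_one)
    finally show ?thesis unfolding failure_rate_def .
  qed
  ultimately show "Q.indep_vars (\<lambda>_. borel) (\<lambda>i \<omega>. ?f (Z i \<omega>)) S \<and>
    (\<forall>i\<in>S. distr ?C borel (\<lambda>\<omega>. ?f (Z i \<omega>))
      = distr (measure_pmf (bernoulli_pmf (failure_rate D v U e t1 t2))) borel of_bool)"
    by blast
qed

end
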